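(* Let $\varphi:\mathbb{R}^n\to\mathbb{R}$ be a $\mathcal{C}^{1,1}$-smooth function such that for all $x\in\mathbb{R}^n$ and $u\in\mathbb{R}^n\setminus\{0\}$ with $\langle\nabla\varphi(x),u\rangle=0$ there exists $z\in\widehat\partial^2\varphi(x)(u)$ with $\langle z,u\rangle>0$. Then $\varphi$ is strictly pseudoconvex.
   Context: $\mathcal{C}^{1,1}$-smooth: $\varphi$ is Fréchet differentiable on $\mathbb{R}^n$ and its gradient $\nabla\varphi:\mathbb{R}^n\to\mathbb{R}^n$ is locally Lipschitz. Strictly pseudoconvex (for differentiable $\varphi$): for all $x,y\in\mathbb{R}^n$ with $x\ne y$, $\varphi(x)\ge\varphi(y)$ implies $\langle\nabla\varphi(x),y-x\rangle<0$. For a proper lower semicontinuous $\psi:\mathbb{R}^m\to(-\infty,\infty]$ and $\bar x$ with $\psi(\bar x)<\infty$, the Fréchet subdifferential is $\widehat\partial\psi(\bar x)=\{x^*\in\mathbb{R}^m : \liminf_{x\to\bar x}\frac{\psi(x)-\psi(\bar x)-\langle x^*,x-\bar x\rangle}{\|x-\bar x\|}\ge 0\}$. For a set $\Omega$ and $p\in\Omega$, the Fréchet normal cone is $\widehat N(p;\Omega)=\widehat\partial\delta_\Omega(p)$, where $\delta_\Omega$ equals $0$ on $\Omega$ and $\infty$ elsewhere. Fréchet second-order subdifferential of a $\mathcal{C}^{1,1}$-smooth $\varphi$: it is the Fréchet coderivative of the gradient mapping, i.e. for $x,u\in\mathbb{R}^n$, $\widehat\partial^2\varphi(x)(u)=\{z\in\mathbb{R}^n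 : (z,-u)\in\widehat N((x,\nabla\varphi(x));\mathrm{gph}\,\nabla\varphi)\}$, where $\mathrm{gph}\,\nabla\varphi=\{(y,\nabla\varphi(y)) : y\in\mathbb{R}^n\}\subset\mathbb{R}^n\times\mathbb{R}^n$. This set may be empty. *)

theory Defs
  imports "HOL-Analysis.Analysis"
begin

definition gradient :: "('a::real_inner \<Rightarrow> real) \<Rightarrow> 'a \<Rightarrow> 'a" where
  "gradient f x = (THE D. GDERIV f x :> D)"

lemma GDERIV_imp_gradient:
  assumes "GDERIV f x :> D"
  shows "gradient f x = D"
  unfolding gradient_def
proof (rule the_equality)
  show "GDERIV f x :> D" by fact
next
  fix E assume "GDERIV f x :> E"
  then have "(\<lambda>h. h \<bullet> E) = (\<lambda>h. h \<bullet> D)"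
    using assms unfolding gderiv_def by (rule has_derivative_unique)
  then have "\<forall>h. h \<bullet> E = h \<bullet> D"
    by (rule fun_cong[THEN allI])
  then show "E = D"
    by (simp add: vector_eq_ldot)
qed

lemma GDERIV_gradient:
  fixes f :: "'a::euclidean_space \<Rightarrow> real"
  assumes "f differentiable (at x)"
  shows "GDERIV f x :> gradient f x"
proof -
  obtain f' where f': "(f has_derivative f') (at x)"
    using assms by (auto simp: differentiable_def)
  then have "linear f'"
    by (rule has_derivative_linear)
  then have "h \<bullet> adjoint f' 1 = f' h * 1" for h
    using adjoint_works[of f' h 1] by (simp only: inner_real_def)
  then have "f' h = h \<bullet> adjoint f' 1" for h
    by (simp only: mult_1_right)
  then have "f' = (\<lambda>h. h \<bullet> adjoint f' 1)"
    by (rule ext)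
  with f' have D: "GDERIV f x :> adjoint f' 1"
    unfolding gderiv_def by (rule has_derivative_eq_rhs)
  show ?thesis
    using D unfolding GDERIV_imp_gradient[OF D] .
qed

definition C11_smooth :: "('a::euclidean_space \<Rightarrow> real) \<Rightarrow> bool" where
  "C11_smooth f \<longleftrightarrow>
     (\<forall>x. f differentiable (at x)) \<and>
     (\<forall>x. \<exists>r>0. \<exists>L. L-lipschitz_on (ball x r) (gradient f))"

definition strictly_pseudoconvex :: "('a::euclidean_space \<Rightarrow> real) \<Rightarrow> bool" where
  "strictly_pseudoconvex f \<longleftrightarrow>
     (\<forall>x. f differentiable (at x)) \<and>
     (\<forall>x y. x \<noteq> y \<longrightarrow> f x \<ge> f y \<longrightarrow> gradient f x \<bullet> (y - x) < 0)"

(* The filter "at x" excludes x itself, so the denominator is never 0.  The subdifferential is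
   taken to be empty at points where psi is not finite, which also rules out ereal
   differences of infinities. *)
definition frechet_subdifferential :: "('a::euclidean_space \<Rightarrow> ereal) \<Rightarrow> 'a \<Rightarrow> 'a set" where
  "frechet_subdifferential \<psi> x =
     {v. \<bar>\<psi> x\<bar> \<noteq> \<infinity> \<and>
         Liminf (at x) (\<lambda>y. (\<psi> y - \<psi> x - ereal (v \<bullet> (y - x))) / ereal (norm (y - x))) \<ge> 0}"

definition set_delta :: "'a set \<Rightarrow> 'a \<Rightarrow> ereal" where
  "set_delta \<Omega> x = (if x \<in> \<Omega> then 0 else \<infinity>)"

definition frechet_normal_cone :: "'a::euclidean_space \<Rightarrow> 'a set \<Rightarrow> 'a set" where
  "frechet_normal_cone p \<Omega> = frechet_subdifferential (set_delta \<Omega>) p"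

definition graph_of :: "('a \<Rightarrow> 'b) \<Rightarrow> ('a \<times> 'b) set" where
  "graph_of F = {(y, F y) | y. True}"

(* The product type carries the Euclidean inner product and norm. *)
definition frechet_second_subdifferential ::
    "('a::euclidean_space \<Rightarrow> real) \<Rightarrow> 'a \<Rightarrow> 'a \<Rightarrow> 'a set" where
  "frechet_second_subdifferential f x u =
     {z. (z, - u) \<in> frechet_normal_cone (x, gradient f x) (graph_of (gradient f))}"

end

theory Submission
  imports Defs
begin

text \<open>
  Restrict \<open>\<phi>\<close> to the segment from \<open>x\<close> to \<open>y\<close>. Testing the normal cone inequality only at the points
  \<open>(x + t u, \<nabla>\<phi>(x + t u))\<close> with \<open>t > 0\<close>, and using the Lipschitz bound to control the distance in the
  graph by \<open>t\<close>, turns \<open>\<langle>z, u\<rangle> > 0\<close> into: at every critical point of the restriction its derivative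
  becomes positive immediately to the right. Hence the restriction has no interior maximum, and if its
  initial slope is nonnegative the initial point is not a maximum either, so the maximum is attained
  at the right end only.
\<close>

text \<open>On \<open>\<Omega>\<close> the indicator vanishes, so the quotient under the
  \<open>Liminf\<close> is the negated inner product over the norm, eventually above
  \<open>- e\<close>. Off \<open>\<Omega>\<close> it is infinite and says nothing, hence the filter
  \<open>at p within \<Omega>\<close>.\<close>

lemma frechet_normal_cone_bound:
  assumes "w \<in> frechet_normal_cone p \<Omega>" and "e > 0"
  shows "\<forall>\<^sub>F q in at p within \<Omega>. w \<bullet> (q - p) < e * norm (q - p)"
proof -
  let ?Q = "\<lambda>q. (set_delta \<Omega> q - set_delta \<Omega> p - ereal (w \<bullet> (q - p))) / ereal (norm (q - p))"
  have p: "p \<in> \<Omega>" and "0 \<le> Liminf (at p) ?Q"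
    using assms(1)
    by (auto simp: frechet_normal_cone_def frechet_subdifferential_def set_delta_def split: if_splits)
  moreover have "ereal (- e) < 0"
    using \<open>e > 0\<close> by simp
  ultimately have "\<forall>\<^sub>F q in at p. ereal (- e) < ?Q q"
    unfolding le_Liminf_iff by blast
  then have "\<forall>\<^sub>F q in at p within \<Omega>. ereal (- e) < ?Q q"
    by (rule filter_leD[OF at_le, rotated]) simp
  moreover have "\<forall>\<^sub>F q in at p within \<Omega>. q \<in> \<Omega> \<and> q \<noteq> p"
    by (auto simp: eventually_at_filter)
  ultimately show ?thesis
  proof eventually_elim
    case (elim q)
    then have "- e < - (w \<bullet> (q - p)) / norm (q - p)" and "norm (q - p) > 0"
      using p by (auto simp: set_delta_def)
    then show ?case
      by (simp add: field_simps)
  qed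
qed

text \<open>Paired with the graph increment along \<open>u\<close>, the normal
  \<open>(z, - u)\<close> gives \<open>t * (z \<bullet> u)\<close> minus the change of
  \<open>gradient f \<bullet> u\<close>. An error bound of \<open>t * (z \<bullet> u)\<close>
  therefore forces that change to be positive.\<close>

lemma frechet_second_subdifferential_imp_gradient_increase:
  fixes f :: "'a::euclidean_space \<Rightarrow> real"
  assumes lip: "L-lipschitz_on (ball x r) (gradient f)" and "r > 0"
    and z: "z \<in> frechet_second_subdifferential f x u" and pos: "z \<bullet> u > 0"
  shows "\<forall>\<^sub>F t in at_right 0. gradient f x \<bullet> u < gradient f (x + t *\<^sub>R u) \<bullet> u"
proof -
  let ?g = "gradient f" and ?q = "\<lambda>t. (x + t *\<^sub>R u, gradient f (x + t *\<^sub>R u))"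
  have "u \<noteq> 0" and L: "L \<ge> 0"
    using pos lip lipschitz_on_nonneg by auto
  \<comment> \<open>Chosen so that \<open>e\<close> times the bound
    \<open>t * ((1 + L) * norm u)\<close> on the graph increment is exactly
    \<open>t * (z \<bullet> u)\<close>.\<close>
  define e where "e = z \<bullet> u / ((1 + L) * norm u)"
  have "e > 0"
    using pos L \<open>u \<noteq> 0\<close> by (simp add: e_def)
  have line: "((\<lambda>t. x + t *\<^sub>R u) \<longlongrightarrow> x) (at_right 0)"
    by (auto intro!: tendsto_eq_intros)
  have "isCont ?g x"
    using lipschitz_on_continuous_on[OF lip] \<open>r > 0\<close> by (simp add: continuous_on_eq_continuous_at)
  then have "(?q \<longlongrightarrow> (x, ?g x)) (at_right 0)"
    by (intro tendsto_Pair line isCont_tendsto_compose[OF _ line])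
  \<comment> \<open>The filter \<open>at\<close> is punctured; since \<open>u\<close> is nonzero,
    the first components already differ.\<close>
  moreover have "\<forall>\<^sub>F t in at_right 0. ?q t \<in> graph_of ?g \<and> ?q t \<noteq> (x, ?g x)"
    using \<open>u \<noteq> 0\<close> by (auto simp: graph_of_def eventually_at_filter)
  ultimately have "filterlim ?q (at (x, ?g x) within graph_of ?g) (at_right 0)"
    by (simp add: filterlim_at)
  moreover have "(z, - u) \<in> frechet_normal_cone (x, ?g x) (graph_of ?g)"
    using z by (simp add: frechet_second_subdifferential_def)
  ultimately have
    "\<forall>\<^sub>F t in at_right 0. (z, - u) \<bullet> (?q t - (x, ?g x)) < e * norm (?q t - (x, ?g x))"
    by (intro eventually_compose_filterlim[OF frechet_normal_cone_bound[OF _ \<open>e > 0\<close>]])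
  moreover have "\<forall>\<^sub>F t in at_right 0. x + t *\<^sub>R u \<in> ball x r"
    using \<open>r > 0\<close> by (intro topological_tendstoD[OF line]) auto
  moreover have "\<forall>\<^sub>F t in at_right 0. (t::real) > 0"
    by (simp add: eventually_at_filter)
  ultimately show ?thesis
  proof eventually_elim
    case (elim t)
    let ?d = "?g (x + t *\<^sub>R u) - ?g x"
    have "norm ?d \<le> L * norm (t *\<^sub>R u)"
      using lipschitz_onD[OF lip elim(2), of x] \<open>r > 0\<close> by (simp add: dist_norm)
    moreover have "norm (?q t - (x, ?g x)) \<le> norm (t *\<^sub>R u) + norm ?d"
      using norm_Pair_le[of "t *\<^sub>R u" ?d] by simp
    ultimately have "norm (?q t - (x, ?g x)) \<le> t * ((1 + L) * norm u)"
      using \<open>t > 0\<close> by (simp add: algebra_simps)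
    then have "e * norm (?q t - (x, ?g x)) \<le> e * (t * ((1 + L) * norm u))"
      using \<open>e > 0\<close> by (intro mult_left_mono) auto
    also have "\<dots> = t * (z \<bullet> u)"
      using L \<open>u \<noteq> 0\<close> by (simp add: e_def)
    finally have "(z, - u) \<bullet> (?q t - (x, ?g x)) < t * (z \<bullet> u)"
      using elim(1) by linarith
    then show ?case
      by (simp add: inner_diff_right inner_commute)
  qed
qed

text \<open>A positive slope at \<open>t\<close> suffices by itself; at slope zero the mean value
  theorem transfers the positivity of \<open>f'\<close> just to the right of
  \<open>t\<close>.\<close>

lemma eventually_at_right_less:
  fixes f f' :: "real \<Rightarrow> real"
  assumes deriv: "\<And>s. (f has_real_derivative f' s) (at s)"
    and "f' t \<ge> 0" and crit: "f' t = 0 \<Longrightarrow> \<forall>\<^sub>F s in at_right t. f' s > 0"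
  shows "\<forall>\<^sub>F s in at_right t. f t < f s"
proof (cases "f' t = 0")
  case True
  then obtain b where b: "b > t" "\<And>s. t < s \<Longrightarrow> s < b \<Longrightarrow> f' s > 0"
    using crit by (auto simp: eventually_at_right_field)
  have "f t < f s" if "t < s" "s < b" for s
  proof -
    obtain c where "t < c" "c < s" "f s - f t = (s - t) * f' c"
      using MVT2[OF \<open>t < s\<close>, of f f'] deriv by blast
    then show ?thesis
      using b(2)[of c] that by (smt (verit) mult_pos_pos)
  qed
  then show ?thesis
    using b(1) by (auto simp: eventually_at_right_field)
next
  case False
  then obtain d where d: "d > 0" "\<And>h. 0 < h \<Longrightarrow> h < d \<Longrightarrow> f t < f (t + h)"
    using DERIV_pos_inc_right[OF deriv, of t] \<open>f' t \<ge> 0\<close> by auto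
  have "f t < f s" if "t < s" "s < t + d" for s
    using d(2)[of "s - t"] that by simp
  then show ?thesis
    using d(1) by (auto simp: eventually_at_right_field intro!: exI[of _ "t + d"])
qed

lemma less_if_derivative_increases_at_critical_points:
  fixes f f' :: "real \<Rightarrow> real"
  assumes "a < b" and deriv: "\<And>s. (f has_real_derivative f' s) (at s)"
    and crit: "\<And>s. f' s = 0 \<Longrightarrow> \<forall>\<^sub>F r in at_right s. f' r > 0"
    and "f' a \<ge> 0"
  shows "f a < f b"
proof -
  have right: "\<exists>s. t < s \<and> s < b \<and> f t < f s" if t: "f' t \<ge> 0" "t < b" for t
  proof -
    have "\<forall>\<^sub>F s in at_right t. f t < f s"
      using eventually_at_right_less[OF deriv t(1)] crit by blast
    moreover have "\<forall>\<^sub>F s in at_right t. t < s \<and> s < b"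
      using t(2) by (auto simp: eventually_at_right_field)
    ultimately have "\<forall>\<^sub>F s in at_right t. t < s \<and> s < b \<and> f t < f s"
      by eventually_elim simp
    then show ?thesis
      by (rule eventually_happens'[rotated]) simp
  qed
  have "continuous_on {a..b} f"
    using deriv by (meson DERIV_isCont continuous_at_imp_continuous_on)
  then obtain c where c: "c \<in> {a..b}" and max: "\<And>s. s \<in> {a..b} \<Longrightarrow> f s \<le> f c"
    using continuous_attains_sup[of "{a..b}" f] \<open>a < b\<close> by auto
  have "c = b"
  proof (rule ccontr)
    assume "c \<noteq> b"
    then have "c < b"
      using c by simp
    have "f' c \<ge> 0"
    proof (cases "c = a")
      case False
      \<comment> \<open>Fermat's rule at an interior maximum; the radius
        \<open>min (c - a) (b - c)\<close> keeps the neighbourhood inside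
        \<open>{a..b}\<close>.\<close>
      then have "f' c = 0"
        using c \<open>c < b\<close> max DERIV_local_max[OF deriv, of "min (c - a) (b - c)" c]
        by (auto simp: abs_if split: if_splits)
      then show ?thesis by simp
    qed (use \<open>f' a \<ge> 0\<close> in simp)
    from right[OF this \<open>c < b\<close>] obtain s where "c < s" "s < b" "f c < f s"
      by blast
    then show False
      using c max[of s] by simp
  qed
  \<comment> \<open>Maximality at \<open>b\<close> yields only a weak inequality with
    \<open>f a\<close>; an intermediate point strictly above \<open>f a\<close> makes it
    strict.\<close>
  moreover obtain s where "a < s" "s < b" "f a < f s"
    using right[OF \<open>f' a \<ge> 0\<close> \<open>a < b\<close>] by blast
  ultimately show ?thesis
    using max[of s] by simp
qed

lemma has_real_derivative_along_line:
  fixes f :: "'a::euclidean_space \<Rightarrow> real"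
  assumes "f differentiable (at (x + t *\<^sub>R u))"
  shows "((\<lambda>t. f (x + t *\<^sub>R u)) has_real_derivative gradient f (x + t *\<^sub>R u) \<bullet> u) (at t)"
proof -
  have "(f has_derivative (\<lambda>h. h \<bullet> gradient f (x + t *\<^sub>R u))) (at (x + t *\<^sub>R u))"
    using GDERIV_gradient[OF assms] by (simp add: gderiv_def)
  moreover have "((\<lambda>t. x + t *\<^sub>R u) has_derivative (\<lambda>h. h *\<^sub>R u)) (at t)"
    by (auto intro!: derivative_eq_intros)
  ultimately have
    "((\<lambda>t. f (x + t *\<^sub>R u)) has_derivative (\<lambda>h. (h *\<^sub>R u) \<bullet> gradient f (x + t *\<^sub>R u))) (at t)"
    by (rule has_derivative_compose[rotated])
  then show ?thesis
    by (simp add: has_field_derivative_def inner_commute mult_commute_abs)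
qed

theorem theorem4p4:
  fixes \<phi> :: "real ^ 'n \<Rightarrow> real"
  assumes "C11_smooth \<phi>"
    and "\<And>x u. u \<noteq> 0 \<Longrightarrow> gradient \<phi> x \<bullet> u = 0 \<Longrightarrow>
           \<exists>z \<in> frechet_second_subdifferential \<phi> x u. z \<bullet> u > 0"
  shows "strictly_pseudoconvex \<phi>"
proof -
  have diff: "\<phi> differentiable (at x)" for x
    using assms(1) by (simp add: C11_smooth_def)
  have "gradient \<phi> x \<bullet> (y - x) < 0" if "x \<noteq> y" "\<phi> x \<ge> \<phi> y" for x y
  proof (rule ccontr)
    let ?u = "y - x"
    let ?f' = "\<lambda>t. gradient \<phi> (x + t *\<^sub>R ?u) \<bullet> ?u"
    assume "\<not> gradient \<phi> x \<bullet> ?u < 0"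
    then have "?f' 0 \<ge> 0" by simp
    \<comment> \<open>The direction stays fixed while the base point moves along the line, so the
      second-order hypothesis applies at every critical parameter \<open>s\<close>.\<close>
    have crit: "\<forall>\<^sub>F r in at_right s. ?f' r > 0" if "?f' s = 0" for s
    proof -
      let ?x = "x + s *\<^sub>R ?u"
      obtain z where z: "z \<in> frechet_second_subdifferential \<phi> ?x ?u" "z \<bullet> ?u > 0"
        using assms(2)[of ?u ?x] \<open>?f' s = 0\<close> \<open>x \<noteq> y\<close> by auto
      obtain r L where "r > 0" "L-lipschitz_on (ball ?x r) (gradient \<phi>)"
        using assms(1) unfolding C11_smooth_def by blast
      then have "\<forall>\<^sub>F t in at_right 0. gradient \<phi> ?x \<bullet> ?u < gradient \<phi> (?x + t *\<^sub>R ?u) \<bullet> ?u"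
        using z by (intro frechet_second_subdifferential_imp_gradient_increase)
      \<comment> \<open>A step \<open>t\<close> from the base point \<open>?x\<close> is the
        parameter \<open>t + s\<close> on the original line.\<close>
      then have "\<forall>\<^sub>F t in at_right 0. ?f' (t + s) > 0"
        using \<open>?f' s = 0\<close> by (simp add: scaleR_left_distrib add_ac)
      then show ?thesis
        by (subst at_right_to_0) (simp add: eventually_filtermap)
    qed
    \<comment> \<open>Parameters 0 and 1 give \<open>x\<close> and \<open>y\<close>, so this
      contradicts the assumed order of the values.\<close>
    have "\<phi> (x + 0 *\<^sub>R ?u) < \<phi> (x + 1 *\<^sub>R ?u)"
      by (rule less_if_derivative_increases_at_critical_points
          [OF _ has_real_derivative_along_line[OF diff] crit \<open>?f' 0 \<ge> 0\<close>]) simp_all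
    then show False
      using \<open>\<phi> x \<ge> \<phi> y\<close> by simp
  qed
  then show ?thesis
    using diff by (simp add: strictly_pseudoconvex_def)
qed

end
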